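(* For all $a,b\in\mathbb{M}$: (1) $a\mathbb{M}\subseteq b\mathbb{M}\iff b|a$. (2) $a\mathbb{M}\cap b\mathbb{M}=b\mathbb{M}$ if $a|b$; $a\mathbb{M}\cap b\mathbb{M}=a\mathbb{M}$ if $b|a$; and $a\mathbb{M}\cap b\mathbb{M}=\emptyset$ otherwise. (3) $a\mathbb{M}\vee b\mathbb{M}\subseteq\gcd(a,b)\mathbb{M}$, and $\gcd(a,b)\mathbb{M}$ is the least principal ideal containing $a\mathbb{M}\vee b\mathbb{M}$.
   Context: $\mathbb{M}$ is the free magma on one generator $1$ (its elements are identified with finite full binary trees), with operation $+$. The product on $\mathbb{M}$ is the unique operation with $x\cdot1=1\cdot x=x$ and $x\cdot(y+z)=x\cdot y+x\cdot z$; it is associative. An element $a$ divides $x$ (on the left), written $a|x$, iff $x=ay$ for some $y\in\mathbb{M}$. $\gcd(x,y)$ is the greatest (with respect to divisibility; equivalently, longest) common left divisor of $x$ and $y$. For $a\in\mathbb{M}$, $a\mathbb{M}=\{ax\mid x\in\mathbb{M}\}$; it is the submagma $\langle a\rangle$ generated by $a$, and sets of this form are called principal ideals. For submagmas $N,N'$, $N\vee N'$ is the submagma generated by $N\cup N'$. *)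

theory Defs
  imports Main "HOL.Hull"
begin

text \<open>The free magma on one generator, as finite full binary trees. Addition is neither
  associative nor commutative, so only the syntactic class \<^class>\<open>plus\<close> is instantiated.\<close>

datatype fmagma = Gen | Node fmagma fmagma

instantiation fmagma :: "{one, plus, times}"
begin

definition one_fmagma :: fmagma where
  "1 = Gen"

definition plus_fmagma :: "fmagma \<Rightarrow> fmagma \<Rightarrow> fmagma" where
  "x + y = Node x y"

primrec times_fmagma :: "fmagma \<Rightarrow> fmagma \<Rightarrow> fmagma" where
  "x * Gen = x"
| "x * Node y z = Node (x * y) (x * z)"

instance ..

end

lemma fmagma_induct [case_names one plus]:
  fixes x :: fmagma
  assumes "P 1" and "\<And>y z. P y \<Longrightarrow> P z \<Longrightarrow> P (y + z)"
  shows "P x"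
  by (induction x) (use assms in \<open>simp_all add: one_fmagma_def plus_fmagma_def\<close>)

lemma fmagma_mult_plus: "x * (y + z) = x * y + x * z" for x y z :: fmagma
  by (simp add: plus_fmagma_def)

instance fmagma :: monoid_mult
proof
  fix x y z :: fmagma
  show "x * 1 = x"
    by (simp add: one_fmagma_def)
  show "1 * x = x"
    by (induction x) (simp_all add: one_fmagma_def)
  show "x * y * z = x * (y * z)"
    by (induction z) simp_all
qed

instance fmagma :: Rings.dvd ..

lemma fmagma_mult_unique:
  fixes m :: "fmagma \<Rightarrow> fmagma \<Rightarrow> fmagma"
  assumes "\<And>x. m x 1 = x" and "\<And>x y z. m x (y + z) = m x y + m x z"
  shows "m = (*)"
proof (intro ext)
  show "m x y = x * y" for x y
    by (induction y rule: fmagma_induct) (simp_all add: assms fmagma_mult_plus)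
qed

text \<open>The product is not commutative. The library's \<^term>\<open>(dvd)\<close> unfolds to
  \<open>\<exists>k. x = a * k\<close>, which is precisely left divisibility.\<close>

definition is_fmagma_gcd :: "fmagma \<Rightarrow> fmagma \<Rightarrow> fmagma \<Rightarrow> bool" where
  "is_fmagma_gcd x y d \<longleftrightarrow>
     d dvd x \<and> d dvd y \<and> (\<forall>c. c dvd x \<and> c dvd y \<longrightarrow> c dvd d)"

text \<open>The library's \<^class>\<open>gcd\<close> class requires a zero, so it does not apply here.\<close>

definition fmagma_gcd :: "fmagma \<Rightarrow> fmagma \<Rightarrow> fmagma" where
  "fmagma_gcd x y = (THE d. is_fmagma_gcd x y d)"

lemma fmagma_size_mult: "size a \<le> size (a * k) \<and> (size (a * k) = size a \<longrightarrow> k = 1)"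
  for a k :: fmagma
  by (induction k) (auto simp: one_fmagma_def)

lemma fmagma_dvd_size: "a dvd x \<Longrightarrow> size a \<le> size x" for a x :: fmagma
  by (auto simp: dvd_def fmagma_size_mult)

lemma fmagma_dvd_antisym:
  fixes a b :: fmagma
  assumes "a dvd b" "b dvd a"
  shows "a = b"
proof -
  from assms obtain k where k: "b = a * k"
    by (auto simp: dvd_def)
  moreover from assms have "size a = size b"
    by (simp add: fmagma_dvd_size le_antisym)
  ultimately have "k = 1"
    using fmagma_size_mult by metis
  with k show ?thesis
    by simp
qed

lemma fmagma_mult_eq_mult: "a * u = b * v \<Longrightarrow> a dvd b \<or> b dvd a" for a b u v :: fmagma
proof (induction u arbitrary: v)
  case Gen
  then show ?case by (auto simp: dvd_def)
next
  case (Node u1 u2)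
  show ?case
  proof (cases v)
    case Gen
    then show ?thesis using Node.prems by (metis dvdI times_fmagma.simps(1))
  next
    case (Node v1 v2)
    then show ?thesis using Node.prems Node.IH(1) by auto
  qed
qed

lemma is_fmagma_gcd_ex1: "\<exists>!d. is_fmagma_gcd x y d"
proof (rule ex_ex1I)
  let ?P = "\<lambda>d. d dvd x \<and> d dvd y"
  have "?P 1" by (simp add: dvd_def)
  moreover have "\<forall>d. ?P d \<longrightarrow> size d < Suc (size x)"
    using fmagma_dvd_size le_imp_less_Suc by blast
  ultimately obtain d where d: "?P d" "\<And>c. ?P c \<Longrightarrow> size c \<le> size d"
    using ex_has_greatest_nat [of ?P 1 size "Suc (size x)"] by blast
  have "c dvd d" if c: "?P c" for c
  proof -
    from c d(1) have "c dvd d \<or> d dvd c"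
      unfolding dvd_def using fmagma_mult_eq_mult [unfolded dvd_def] by metis
    then show ?thesis
    proof
      assume "d dvd c"
      then obtain k where k: "c = d * k" by (auto simp: dvd_def)
      have "size c = size d"
        using d(2) [OF c] fmagma_dvd_size [OF \<open>d dvd c\<close>] by simp
      with k have "d = c * 1" using fmagma_size_mult by (metis mult_1_right)
      then show ?thesis ..
    qed
  qed
  with d(1) show "\<exists>d. is_fmagma_gcd x y d"
    unfolding is_fmagma_gcd_def by blast
next
  show "d = e" if "is_fmagma_gcd x y d" "is_fmagma_gcd x y e" for d e
    using that fmagma_dvd_antisym unfolding is_fmagma_gcd_def by blast
qed

text \<open>The empty set counts as a submagma; this does not affect the submagma generated by a
  nonempty set.\<close>

definition submagma :: "fmagma set \<Rightarrow> bool" where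
  "submagma N \<longleftrightarrow> (\<forall>x\<in>N. \<forall>y\<in>N. x + y \<in> N)"

definition magma_join :: "fmagma set \<Rightarrow> fmagma set \<Rightarrow> fmagma set"  (infixl "\<squnion>\<^sub>m" 65) where
  "N \<squnion>\<^sub>m N' = submagma hull (N \<union> N')"

definition ideal_of :: "fmagma \<Rightarrow> fmagma set" where
  "ideal_of a = {a * x | x. True}"

definition principal_ideal :: "fmagma set \<Rightarrow> bool" where
  "principal_ideal I \<longleftrightarrow> (\<exists>a. I = ideal_of a)"

lemma ideal_of_eq_hull: "ideal_of a = submagma hull {a}"
proof (rule hull_unique [symmetric])
  show "{a} \<subseteq> ideal_of a"
    by (auto simp: ideal_of_def intro: exI [of _ 1])
  show "submagma (ideal_of a)"
    by (auto simp: submagma_def ideal_of_def fmagma_mult_plus [symmetric])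
next
  fix N assume N: "{a} \<subseteq> N" "submagma N"
  have "a * x \<in> N" for x
    by (induction x rule: fmagma_induct) (use N in \<open>auto simp: fmagma_mult_plus submagma_def\<close>)
  then show "ideal_of a \<subseteq> N"
    by (auto simp: ideal_of_def)
qed

end

theory Submission
  imports Defs
begin

text \<open>Membership in \<open>ideal_of a\<close> means left divisibility by \<open>a\<close>, so
  inclusion of principal ideals is divisibility reversed. This settles the first claim and the
  comparable cases of the intersection. The incomparable case rests on
  \<open>fmagma_mult_eq_mult\<close>: two left divisors of one tree are always comparable. For the
  join, \<open>magma_join_subset_ideal_of_iff\<close> identifies the principal ideals above it with
  the common divisors of \<open>a\<close> and \<open>b\<close>; the greatest common divisor then
  generates the least of them.\<close>

lemma mem_ideal_of_iff: "x \<in> ideal_of a \<longleftrightarrow> a dvd x"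
  by (auto simp: ideal_of_def dvd_def)

lemma fmagma_dvd_trans: "c dvd x" if "c dvd b" "b dvd x" for b c x :: fmagma
  using that by (auto simp: dvd_def mult.assoc)

lemma ideal_of_subset_iff: "ideal_of a \<subseteq> ideal_of b \<longleftrightarrow> b dvd a"
proof
  assume "ideal_of a \<subseteq> ideal_of b"
  moreover have "a dvd a"
    by (rule dvdI [of _ _ 1]) simp
  ultimately show "b dvd a"
    unfolding subset_iff mem_ideal_of_iff by blast
next
  assume "b dvd a"
  then show "ideal_of a \<subseteq> ideal_of b"
    unfolding subset_iff mem_ideal_of_iff using fmagma_dvd_trans by blast
qed

text \<open>A common element would have two factorizations \<open>a * u = b * v\<close>. Descending
  to left subtrees on both sides until one cofactor is trivial shows that one of \<open>a\<close>,
  \<open>b\<close> divides the other.\<close>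

lemma ideal_of_disjoint:
  assumes "\<not> a dvd b" "\<not> b dvd a"
  shows "ideal_of a \<inter> ideal_of b = {}"
proof (rule equals0I)
  fix x
  assume "x \<in> ideal_of a \<inter> ideal_of b"
  then obtain u v where "a * u = b * v"
    by (auto simp: ideal_of_def)
  then show False
    using assms fmagma_mult_eq_mult by blast
qed

lemma submagma_ideal_of: "submagma (ideal_of a)"
  by (auto simp: submagma_def ideal_of_def fmagma_mult_plus [symmetric])

text \<open>Since \<open>ideal_of c\<close> is closed under addition, it contains the generated
  submagma as soon as it contains both generating ideals.\<close>

lemma magma_join_subset_ideal_of_iff:
  "ideal_of a \<squnion>\<^sub>m ideal_of b \<subseteq> ideal_of c \<longleftrightarrow> c dvd a \<and> c dvd b"
proof -
  have "ideal_of a \<squnion>\<^sub>m ideal_of b \<subseteq> ideal_of c \<longleftrightarrow> ideal_of a \<union> ideal_of b \<subseteq> ideal_of c"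
    unfolding magma_join_def
    by (meson hull_minimal hull_subset order_trans submagma_ideal_of)
  then show ?thesis
    by (simp add: ideal_of_subset_iff)
qed

lemma is_fmagma_gcd_fmagma_gcd: "is_fmagma_gcd a b (fmagma_gcd a b)"
  unfolding fmagma_gcd_def by (rule theI' [OF is_fmagma_gcd_ex1])

theorem theorem5p2:
  fixes a b :: fmagma
  shows "(ideal_of a \<subseteq> ideal_of b \<longleftrightarrow> b dvd a)
    \<and> ((a dvd b \<longrightarrow> ideal_of a \<inter> ideal_of b = ideal_of b)
       \<and> (b dvd a \<longrightarrow> ideal_of a \<inter> ideal_of b = ideal_of a)
       \<and> (\<not> a dvd b \<and> \<not> b dvd a \<longrightarrow> ideal_of a \<inter> ideal_of b = {}))
    \<and> (ideal_of a \<squnion>\<^sub>m ideal_of b \<subseteq> ideal_of (fmagma_gcd a b)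
       \<and> principal_ideal (ideal_of (fmagma_gcd a b))
       \<and> (\<forall>I. principal_ideal I \<and> ideal_of a \<squnion>\<^sub>m ideal_of b \<subseteq> I
              \<longrightarrow> ideal_of (fmagma_gcd a b) \<subseteq> I))"
proof (intro conjI impI allI)
  show "ideal_of a \<subseteq> ideal_of b \<longleftrightarrow> b dvd a"
    by (rule ideal_of_subset_iff)
  show "ideal_of a \<inter> ideal_of b = ideal_of b" if "a dvd b"
    using that by (simp add: Int_absorb1 ideal_of_subset_iff)
  show "ideal_of a \<inter> ideal_of b = ideal_of a" if "b dvd a"
    using that by (simp add: Int_absorb2 ideal_of_subset_iff)
  show "ideal_of a \<inter> ideal_of b = {}" if "\<not> a dvd b \<and> \<not> b dvd a"
    using that by (simp add: ideal_of_disjoint)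
  show "ideal_of a \<squnion>\<^sub>m ideal_of b \<subseteq> ideal_of (fmagma_gcd a b)"
    using is_fmagma_gcd_fmagma_gcd [of a b]
    by (simp add: magma_join_subset_ideal_of_iff is_fmagma_gcd_def)
  show "principal_ideal (ideal_of (fmagma_gcd a b))"
    by (auto simp: principal_ideal_def)
  \<comment> \<open>Writing \<open>I\<close> as \<open>ideal_of c\<close>, the hypothesis makes
    \<open>c\<close> a common divisor, hence a divisor of the gcd, and inclusion reverses
    divisibility.\<close>
  show "ideal_of (fmagma_gcd a b) \<subseteq> I"
    if "principal_ideal I \<and> ideal_of a \<squnion>\<^sub>m ideal_of b \<subseteq> I" for I
    using that is_fmagma_gcd_fmagma_gcd [of a b]
    unfolding principal_ideal_def is_fmagma_gcd_def
    by (metis magma_join_subset_ideal_of_iff ideal_of_subset_iff)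
qed

end
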